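(* Let $n\geq 2k$ and let $\mathcal{F}\subset\binom{[n]}{k}$ be an intersecting family. Then $$\omega(\mathcal{F})\leq \binom{\binom{n-1}{k-1}}{2}+(n-1)\binom{\binom{n-2}{k-2}}{2}.$$ Moreover, if $n>2k$, then equality holds if and only if $\mathcal{F}=\mathcal{S}^k_1$ up to a permutation of $[n]$, i.e. if and only if there is $x\in[n]$ with $\mathcal{F}=\{S\in\binom{[n]}{k}: x\in S\}$.
   Context: $[n]=\{1,\ldots,n\}$ and $\binom{[n]}{k}$ denotes the family of all $k$-element subsets of $[n]$. A family $\mathcal{F}$ is intersecting if $F_1\cap F_2\neq\emptyset$ for all $F_1,F_2\in\mathcal{F}$. For a family $\mathcal{F}$, $\omega(\mathcal{F})=\sum_{\{A,B\}\subset\mathcal{F}}|A\cap B|$, the sum over all unordered pairs of distinct members of $\mathcal{F}$. $\mathcal{S}^k_1=\{S\in\binom{[n]}{k}:1\in S\}$.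
   Formalization: The equality characterization excludes the case k = 1 with F empty, where it is false: for k = 1, n > 2 both ω(∅) and the bound are 0, yet the empty family is not a star {{x}}; the inequality itself is proved without restriction. *)

theory Defs
  imports "HOL-Combinatorics.Permutations"
begin

definition ksubsets :: "nat \<Rightarrow> nat \<Rightarrow> nat set set" where
  "ksubsets n k = {S. S \<subseteq> {1..n} \<and> card S = k}"

text \<open>The two members need not be distinct, so an intersecting family does not contain the
  empty set.\<close>
definition intersecting :: "'a set set \<Rightarrow> bool" where
  "intersecting F \<longleftrightarrow> (\<forall>A\<in>F. \<forall>B\<in>F. A \<inter> B \<noteq> {})"

text \<open>The summation index \<open>P\<close> ranges over the unordered pairs \<open>{A, B}\<close> of distinct members,
  for which \<open>\<Inter>P = A \<inter> B\<close>.\<close>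
definition omega :: "'a set set \<Rightarrow> nat" where
  "omega F = (\<Sum>P | P \<subseteq> F \<and> card P = 2. card (\<Inter>P))"

definition full_star :: "nat \<Rightarrow> nat \<Rightarrow> nat \<Rightarrow> nat set set" where
  "full_star n k x = {S \<in> ksubsets n k. x \<in> S}"

text \<open>Truncated subtraction is harmless here: whenever \<open>n < 2\<close> or \<open>k < 2\<close> (and \<open>2 * k \<le> n\<close>),
  the affected binomial coefficient is at most 1, so choosing 2 from it gives 0, exactly as
  under the convention that a binomial coefficient with negative lower index is 0.\<close>
definition omega_bound :: "nat \<Rightarrow> nat \<Rightarrow> nat" where
  "omega_bound n k =
     (((n - 1) choose (k - 1)) choose 2) + (n - 1) * (((n - 2) choose (k - 2)) choose 2)"

end

theory Submission
  imports Defs Complex_Main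
begin

text \<open>Write \<open>d x\<close> for the number of members of \<open>F\<close> containing \<open>x\<close>; then \<open>omega F\<close> is the sum of
  the binomials \<open>d x choose 2\<close>. The sum of the \<open>(d x)\<^sup>2\<close> is controlled by the projection of the
  indicator function of \<open>F\<close> onto the affine functions \<open>S \<mapsto> c + (\<Sum>x\<in>S. w x)\<close> on the \<open>k\<close>-sets:
  since the projection does not increase the norm, \<open>omega F\<close> is at most an increasing quadratic
  function of \<open>card F\<close>, and the Erdos--Ko--Rado bound on \<open>card F\<close> gives the inequality.
  If equality holds, the indicator function is itself affine, and an intersecting family with an
  affine indicator function is a star when \<open>n > 2 * k\<close>: swapping single elements shows that
  membership in \<open>F\<close> is monotone in the weights, and two elements of larger weight would yield
  disjoint members.\<close>

section \<open>Counting k-sets\<close>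

lemma finite_ksubsets [simp]: "finite (ksubsets n k)"
  unfolding ksubsets_def by (rule finite_subset[of _ "Pow {1..n}"]) auto

lemma card_ksubsets: "card (ksubsets n k) = n choose k"
  unfolding ksubsets_def using n_subsets[of "{1..n}" k] by simp

lemma finite_member_ksubsets: "S \<in> ksubsets n k \<Longrightarrow> finite S"
  unfolding ksubsets_def by (auto intro: finite_subset)

text \<open>Removing \<open>T\<close> leaves an arbitrary subset of the complement of size
  \<open>k - card T\<close>. One-point and two-point \<open>T\<close> give the degrees and codegrees
  of the full family.\<close>

lemma card_ksubsets_superset:
  assumes T: "T \<subseteq> {1..n}" "card T \<le> k"
  shows "card {S \<in> ksubsets n k. T \<subseteq> S} = (n - card T) choose (k - card T)"
proof -
  have fT: "finite T" using T finite_subset by blast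
  have "bij_betw (\<lambda>S. S - T) {S \<in> ksubsets n k. T \<subseteq> S}
          {B. B \<subseteq> {1..n} - T \<and> card B = k - card T}"
  proof (rule bij_betw_byWitness[where f' = "\<lambda>B. B \<union> T"])
    show "(\<lambda>S. S - T) ` {S \<in> ksubsets n k. T \<subseteq> S}
            \<subseteq> {B. B \<subseteq> {1..n} - T \<and> card B = k - card T}"
      using fT by (auto simp: ksubsets_def card_Diff_subset)
    show "(\<lambda>B. B \<union> T) ` {B. B \<subseteq> {1..n} - T \<and> card B = k - card T}
            \<subseteq> {S \<in> ksubsets n k. T \<subseteq> S}"
    proof clarsimp
      fix B assume B: "B \<subseteq> {Suc 0..n} - T" "card B = k - card T"
      have "finite B" using B(1) finite_subset by blast
      then have "card (B \<union> T) = card B + card T"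
        using B(1) fT by (intro card_Un_disjoint) auto
      then show "B \<union> T \<in> ksubsets n k"
        using B T by (auto simp: ksubsets_def)
    qed
  qed auto
  then have "card {S \<in> ksubsets n k. T \<subseteq> S}
      = card {B. B \<subseteq> {1..n} - T \<and> card B = k - card T}"
    by (rule bij_betw_same_card)
  also have "\<dots> = card ({1..n} - T) choose (k - card T)"
    by (rule n_subsets) simp
  also have "card ({1..n} - T) = n - card T"
    using T fT by (simp add: card_Diff_subset)
  finally show ?thesis .
qed

section \<open>The Erdos--Ko--Rado bound\<close>

text \<open>A block of \<open>k\<close> cyclically consecutive points; residues are shifted by one
  to land in \<open>{1..n}\<close>.\<close>

definition arc :: "nat \<Rightarrow> nat \<Rightarrow> nat \<Rightarrow> nat set" where
  "arc n k i = (\<lambda>j. (i + j) mod n + 1) ` {..<k}"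

lemma arc_in_ksubsets:
  assumes "k \<le> n" "0 < n"
  shows "arc n k i \<in> ksubsets n k"
proof -
  have "inj_on (\<lambda>j. (i + j) mod n + 1) {..<k}"
  proof (rule inj_onI)
    fix a b assume ab: "a \<in> {..<k}" "b \<in> {..<k}" "(i + a) mod n + 1 = (i + b) mod n + 1"
    then have "int ((i + a) mod n) = int ((i + b) mod n)" by simp
    then have "int a mod int n = int b mod int n"
      by (simp add: zmod_int mod_eq_dvd_iff)
    then show "a = b" using ab assms by simp
  qed
  moreover have "arc n k i \<subseteq> {1..n}"
    unfolding arc_def using assms by (auto simp: Suc_le_eq)
  ultimately show ?thesis
    by (simp add: ksubsets_def arc_def card_image)
qed

text \<open>Adding \<open>n\<close> keeps the natural subtraction from truncating; integer residues
  then allow ordinary algebra with offsets.\<close>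

lemma int_mod_offset:
  assumes "i \<le> n"
  shows "int ((j + n - i) mod n) = (int j - int i) mod int n"
proof -
  have "int ((j + n - i) mod n) = (int j - int i + int n) mod int n"
    using assms by (simp add: zmod_int of_nat_diff algebra_simps)
  then show ?thesis by simp
qed

text \<open>A common point gives \<open>i' - i = j - j'\<close> modulo \<open>n\<close> with
  \<open>j, j' < k\<close>: a nonnegative difference is an offset below \<open>k\<close>, a negative
  one wraps around to above \<open>n - k\<close>.\<close>

lemma arc_meet_offset:
  assumes "2 * k \<le> n" "0 < n" "i < n" "i' < n" "arc n k i \<inter> arc n k i' \<noteq> {}"
  shows "(i' + n - i) mod n < k \<or> n - k < (i' + n - i) mod n"
proof -
  obtain j j' where j: "j < k" "j' < k" "(i + j) mod n = (i' + j') mod n"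
    using assms(5) by (auto simp: arc_def)
  have *: "(int i' - int i) mod int n = (int j - int j') mod int n"
  proof -
    have "int ((i + j) mod n) = int ((i' + j') mod n)" using j by simp
    then have "(int i + int j) mod int n = (int i' + int j') mod int n"
      by (simp add: zmod_int)
    then show ?thesis
      by (simp add: mod_eq_dvd_iff algebra_simps dvd_diff_commute)
  qed
  have **: "int ((i' + n - i) mod n) = (int i' - int i) mod int n"
    using assms by (intro int_mod_offset) simp
  show ?thesis
  proof (cases "j' \<le> j")
    case True
    then have "(int j - int j') mod int n = int j - int j'"
      using j assms by (intro mod_pos_pos_trivial) auto
    then show ?thesis using * ** j by linarith
  next
    case False
    have "(int j - int j') mod int n = (int j - int j' + int n) mod int n" by simp
    also have "\<dots> = int j - int j' + int n"
      using False j assms by (intro mod_pos_pos_trivial) auto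
    finally show ?thesis using * ** j False by linarith
  qed
qed

text \<open>Offsets from a fixed start in \<open>I\<close> lie below \<open>k\<close> or above
  \<open>n - k\<close>. Grouping \<open>d\<close> with \<open>d + (n - k)\<close> leaves
  \<open>k\<close> classes, and distinct offsets in one class belong to disjoint arcs.\<close>

lemma card_intersecting_arcs_le:
  assumes nk: "2 * k \<le> n" "0 < n"
    and I: "I \<subseteq> {..<n}" "\<And>i j. i \<in> I \<Longrightarrow> j \<in> I \<Longrightarrow> arc n k i \<inter> arc n k j \<noteq> {}"
  shows "card I \<le> k"
proof (cases "I = {}")
  case False
  then obtain i0 where i0: "i0 \<in> I" by blast
  define d where "d i = (i + n - i0) mod n" for i
  define \<phi> where "\<phi> i = (if d i < k then d i else d i - (n - k))" for i
  have dlt: "d i < n" for i using nk by (simp add: d_def)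
  have dcase: "d i < k \<or> n - k < d i" if "i \<in> I" for i
    unfolding d_def using arc_meet_offset[of k n i0 i] nk I i0 that by blast
  have dint: "int (d i) = (int i - int i0) mod int n" if "i \<in> I" for i
    unfolding d_def using i0 I(1) by (intro int_mod_offset) auto
  have d_inj: "i = j" if "i \<in> I" "j \<in> I" "d i = d j" for i j
  proof -
    have "(int i - int i0) mod int n = (int j - int i0) mod int n"
      using dint that by metis
    then have "int i mod int n = int j mod int n"
      by (simp add: mod_eq_dvd_iff)
    moreover have "i < n" "j < n" using that I(1) by auto
    ultimately show ?thesis by simp
  qed
  text \<open>Starting points at offsets \<open>d\<close> and \<open>d - k\<close> give adjacent, hence disjoint, arcs.\<close>
  have clash: False if ij: "i \<in> I" "j \<in> I" "d j = d i + (n - k)" "d i < k" for i j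
  proof -
    have "(i + n - j) mod n < k \<or> n - k < (i + n - j) mod n"
      using arc_meet_offset[of k n j i] nk I ij by blast
    \<comment> \<open>Seen from \<open>j\<close>, the other arc starts exactly \<open>k\<close>
      steps later, and \<open>k\<close> lies in neither permitted range because
      \<open>k \<le> n - k\<close>.\<close>
    moreover have "(i + n - j) mod n = k"
    proof -
      have "int ((i + n - j) mod n) = (int i - int j) mod int n"
        using I(1) ij by (intro int_mod_offset) auto
      also have "\<dots> = ((int i - int i0) - (int j - int i0)) mod int n" by simp
      also have "\<dots> = (int (d i) - int (d j)) mod int n"
        unfolding dint[OF ij(1)] dint[OF ij(2)] by (simp only: mod_diff_eq)
      also have "\<dots> = (int k - int n) mod int n"
        using ij nk by (simp add: of_nat_diff)
      also have "\<dots> = int k mod int n" by simp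
      also have "\<dots> = int k" using nk dlt[of i] ij by (intro mod_pos_pos_trivial) auto
      finally show ?thesis by simp
    qed
    ultimately show False using nk dlt[of j] ij by linarith
  qed
  have "inj_on \<phi> I"
  proof (rule inj_onI)
    fix i j assume ij: "i \<in> I" "j \<in> I" "\<phi> i = \<phi> j"
    consider "d i < k" "d j < k" | "\<not> d i < k" "\<not> d j < k" | "d i < k" "\<not> d j < k"
      | "\<not> d i < k" "d j < k" by blast
    then show "i = j"
    proof cases
      case 1 then show ?thesis using ij d_inj by (simp add: \<phi>_def)
    next
      case 2
      then have "d i = d j" using ij dcase[of i] dcase[of j] by (simp add: \<phi>_def)
      then show ?thesis using ij d_inj by blast
    next
      case 3
      then have "d j = d i + (n - k)" using ij dcase[of j] by (simp add: \<phi>_def)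
      then show ?thesis using clash 3 ij by blast
    next
      case 4
      then have "d i = d j + (n - k)" using ij dcase[of i] by (simp add: \<phi>_def)
      then show ?thesis using clash 4 ij by blast
    qed
  qed
  moreover have "\<phi> ` I \<subseteq> {..<k}"
  proof
    fix y assume "y \<in> \<phi> ` I"
    then obtain i where "i \<in> I" "y = \<phi> i" by blast
    then show "y \<in> {..<k}" using dcase[of i] dlt[of i] nk by (auto simp: \<phi>_def)
  qed
  ultimately show ?thesis using card_inj_on_le[of \<phi> I "{..<k}"] by simp
qed simp

section \<open>Permutations acting on k-sets\<close>

lemma ksubsets_permutes_image:
  assumes "A \<in> ksubsets n k" "p permutes {1..n}"
  shows "p ` A \<in> ksubsets n k"
proof -
  have "p ` A \<subseteq> {1..n}"
    using assms permutes_image[OF assms(2)] by (auto simp: ksubsets_def)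
  moreover have "card (p ` A) = card A"
    using permutes_inj[OF assms(2)] by (meson card_image inj_on_subset subset_UNIV)
  ultimately show ?thesis using assms by (simp add: ksubsets_def)
qed

lemma ksubsets_permutes_transitive:
  assumes "A \<in> ksubsets n k" "B \<in> ksubsets n k"
  obtains p where "p permutes {1..n}" "p ` A = B"
proof -
  have AB: "A \<subseteq> {1..n}" "B \<subseteq> {1..n}" "card A = card B" "finite A" "finite B"
    using assms assms[THEN finite_member_ksubsets] by (simp_all add: ksubsets_def)
  obtain f where f: "bij_betw f A B"
    using AB finite_same_card_bij by blast
  have "card ({1..n} - A) = card ({1..n} - B)"
    using AB by (simp add: card_Diff_subset)
  then obtain g where g: "bij_betw g ({1..n} - A) ({1..n} - B)"
    using finite_same_card_bij by (metis finite_Diff finite_atLeastAtMost)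
  define p where "p x = (if x \<in> A then f x else if x \<in> {1..n} then g x else x)" for x
  have "bij_betw p A B"
    using f by (rule bij_betw_cong[THEN iffD1, rotated]) (simp add: p_def)
  moreover have "bij_betw p ({1..n} - A) ({1..n} - B)"
    using g by (rule bij_betw_cong[THEN iffD1, rotated]) (simp add: p_def)
  ultimately have "bij_betw p (A \<union> ({1..n} - A)) (B \<union> ({1..n} - B))"
    by (rule bij_betw_combine) auto
  then have "bij_betw p {1..n} {1..n}"
    using AB by (simp add: Un_absorb1)
  then have "p permutes {1..n}"
    using AB by (intro bij_imp_permutes) (auto simp: p_def)
  moreover have "p ` A = B" using \<open>bij_betw p A B\<close> by (simp add: bij_betw_def)
  ultimately show thesis using that by blast
qed

text \<open>The image of \<open>A\<close> partitions all permutations into classes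
  \<open>Q C\<close>. Composing with a permutation that carries \<open>C\<close> to \<open>D\<close>
  injects \<open>Q C\<close> into \<open>Q D\<close>, so all classes have equal size.\<close>

lemma card_permutes_image_eq:
  assumes A: "A \<in> ksubsets n k" and B: "B \<in> ksubsets n k"
  shows "card {p. p permutes {1..n} \<and> p ` A = B} * (n choose k) = fact n"
proof -
  define Q where "Q B = {p. p permutes {1..n} \<and> p ` A = B}" for B
  have fQ: "finite (Q C)" for C
    by (rule finite_subset[OF _ finite_permutations[of "{1..n}"]]) (auto simp: Q_def)
  have le: "card (Q C) \<le> card (Q D)" if CD: "C \<in> ksubsets n k" "D \<in> ksubsets n k" for C D
  proof -
    obtain s where s: "s permutes {1..n}" "s ` C = D"
      using CD by (rule ksubsets_permutes_transitive)
    have "inj_on (\<lambda>p. s \<circ> p) (Q C)"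
      using fun.inj_map[OF permutes_inj[OF s(1)]] by (rule inj_on_subset) simp
    moreover have "(\<lambda>p. s \<circ> p) ` Q C \<subseteq> Q D"
    proof (rule image_subsetI)
      fix p assume "p \<in> Q C"
      then show "s \<circ> p \<in> Q D"
        using s by (simp add: Q_def permutes_compose flip: image_image)
    qed
    ultimately show ?thesis using fQ by (rule card_inj_on_le)
  qed
  have "fact n = card {p. p permutes {1..n}}"
    by (rule card_permutations[symmetric]) auto
  also have "{p. p permutes {1..n}} = (\<Union>C\<in>ksubsets n k. Q C)"
    using ksubsets_permutes_image[OF A] by (auto simp: Q_def)
  also have "card \<dots> = (\<Sum>C\<in>ksubsets n k. card (Q C))"
    using fQ by (intro card_UN_disjoint) (auto simp: Q_def)
  also have "\<dots> = (\<Sum>C\<in>ksubsets n k. card (Q B))"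
    using le B by (intro sum.cong refl antisym) auto
  finally show ?thesis by (simp add: card_ksubsets Q_def mult.commute)
qed

text \<open>Katona's argument: in each of the \<open>n!\<close> cyclic orders of the ground set at most \<open>k\<close> of the
  \<open>n\<close> arcs belong to the family, and every \<open>k\<close>-set is an arc equally often.\<close>

theorem erdos_ko_rado:
  assumes n: "2 * k \<le> n" "0 < k" and F: "F \<subseteq> ksubsets n k" "intersecting F"
  shows "card F \<le> (n - 1) choose (k - 1)"
proof -
  have n0: "0 < n" "k \<le> n" using n by auto
  define P where "P = {p. p permutes {1..n}}"
  have fP: "finite P" by (simp add: P_def finite_permutations)
  have cP: "card P = fact n" unfolding P_def by (rule card_permutations) auto
  have fF: "finite F" using F finite_subset finite_ksubsets by blast
  have le: "card {i\<in>{..<n}. p ` arc n k i \<in> F} \<le> k" if "p \<in> P" for p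
  proof (rule card_intersecting_arcs_le)
    fix i j assume "i \<in> {i\<in>{..<n}. p ` arc n k i \<in> F}" "j \<in> {i\<in>{..<n}. p ` arc n k i \<in> F}"
    then have "p ` arc n k i \<inter> p ` arc n k j \<noteq> {}"
      using F(2) by (simp add: intersecting_def)
    then show "arc n k i \<inter> arc n k j \<noteq> {}"
      using that by (simp add: P_def permutes_inj image_Int[symmetric])
  qed (use n n0 in auto)
  have "(\<Sum>p\<in>P. card {i\<in>{..<n}. p ` arc n k i \<in> F})
      = (\<Sum>i<n. card {p\<in>P. p ` arc n k i \<in> F})"
    using fP by (intro sum_multicount_gen) auto
  also have "\<dots> = (\<Sum>i<n. \<Sum>A\<in>F. card {p\<in>P. p ` arc n k i = A})"
  proof (intro sum.cong refl)
    fix i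
    have "{p\<in>P. p ` arc n k i \<in> F} = (\<Union>A\<in>F. {p\<in>P. p ` arc n k i = A})" by auto
    then show "card {p\<in>P. p ` arc n k i \<in> F} = (\<Sum>A\<in>F. card {p\<in>P. p ` arc n k i = A})"
      using fF fP by (simp only:) (intro card_UN_disjoint, auto)
  qed
  finally have "(\<Sum>i<n. \<Sum>A\<in>F. card {p\<in>P. p ` arc n k i = A}) \<le> fact n * k"
    using sum_bounded_above[of P "\<lambda>p. card {i\<in>{..<n}. p ` arc n k i \<in> F}" k] le cP by simp
  \<comment> \<open>Multiplying by \<open>n choose k\<close> turns each inner count into
    \<open>fact n\<close> and avoids division of naturals.\<close>
  then have "(\<Sum>i<n. \<Sum>A\<in>F. card {p\<in>P. p ` arc n k i = A}) * (n choose k)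
      \<le> fact n * k * (n choose k)" by simp
  moreover have "(\<Sum>i<n. \<Sum>A\<in>F. card {p\<in>P. p ` arc n k i = A}) * (n choose k)
      = (\<Sum>i<n. \<Sum>A\<in>F. fact n)"
    unfolding sum_distrib_right P_def
    using card_permutes_image_eq[OF arc_in_ksubsets] F n0
    by (intro sum.cong refl) (auto simp: subset_iff)
  ultimately have "(\<Sum>i<n. \<Sum>A\<in>F. fact n) \<le> fact n * k * (n choose k)" by (simp only:)
  then have "n * card F * fact n \<le> k * (n choose k) * fact n"
    by (simp add: mult_ac)
  then have "n * card F \<le> k * (n choose k)" by simp
  also have "\<dots> = n * ((n - 1) choose (k - 1))"
    using n binomial_absorption[of "k - 1" "n"] by simp
  finally show ?thesis using n0 by simp
qed

section \<open>Degrees\<close>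

lemma two_times_choose_two: "2 * real (d choose 2) = real d * (real d - 1)"
  by (induction d) (simp_all add: numeral_2_eq_2 algebra_simps)

text \<open>Double counting of points against pairs: \<open>x\<close> lies in both members of a pair
  exactly when the pair is chosen among the members through \<open>x\<close>.\<close>

lemma omega_eq_sum_degrees:
  assumes X: "finite X" and F: "F \<subseteq> Pow X"
  shows "omega F = (\<Sum>x\<in>X. card {A\<in>F. x \<in> A} choose 2)"
proof -
  define \<P> where "\<P> = {P. P \<subseteq> F \<and> card P = 2}"
  have fF: "finite F" using assms finite_subset by blast
  have "finite \<P>" unfolding \<P>_def using fF by simp
  have "card (\<Inter>P) = card {x\<in>X. x \<in> \<Inter>P}" if "P \<in> \<P>" for P
  proof -
    \<comment> \<open>Nonemptiness matters because \<open>\<Inter>{}\<close> is the whole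
      type.\<close>
    have "P \<noteq> {}" "P \<subseteq> Pow X" using that F by (auto simp: \<P>_def)
    then have "{x\<in>X. x \<in> \<Inter>P} = \<Inter>P" by blast
    then show ?thesis by simp
  qed
  then have "omega F = (\<Sum>P\<in>\<P>. card {x\<in>X. x \<in> \<Inter>P})"
    unfolding omega_def \<P>_def by (intro sum.cong) auto
  also have "\<dots> = (\<Sum>x\<in>X. card {P\<in>\<P>. x \<in> \<Inter>P})"
    using X \<open>finite \<P>\<close> by (intro sum_multicount_gen) auto
  also have "\<dots> = (\<Sum>x\<in>X. card {A\<in>F. x \<in> A} choose 2)"
  proof (intro sum.cong refl)
    fix x
    have "{P\<in>\<P>. x \<in> \<Inter>P} = {P. P \<subseteq> {A\<in>F. x \<in> A} \<and> card P = 2}"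
      by (auto simp: \<P>_def)
    then show "card {P\<in>\<P>. x \<in> \<Inter>P} = card {A\<in>F. x \<in> A} choose 2"
      using fF by (simp add: n_subsets)
  qed
  finally show ?thesis .
qed

lemma sum_sum_members:
  fixes w :: "'a \<Rightarrow> real"
  assumes "finite X" "F \<subseteq> Pow X"
  shows "(\<Sum>A\<in>F. \<Sum>x\<in>A. w x) = (\<Sum>x\<in>X. real (card {A\<in>F. x \<in> A}) * w x)"
proof -
  have fF: "finite F" using assms finite_subset by blast
  have "(\<Sum>A\<in>F. \<Sum>x\<in>A. w x) = (\<Sum>A\<in>F. \<Sum>x\<in>{x\<in>X. x \<in> A}. w x)"
    using assms by (intro sum.cong refl) auto
  also have "\<dots> = (\<Sum>x\<in>X. \<Sum>A\<in>{A\<in>F. x \<in> A}. w x)"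
    using assms fF by (intro sum.swap_restrict) auto
  finally show ?thesis by simp
qed

lemma ksubsets_subset_Pow: "ksubsets n k \<subseteq> Pow {1..n}"
  by (auto simp: ksubsets_def)

lemma card_ksubsets_member:
  assumes "x \<in> {1..n}" "1 \<le> k"
  shows "card {S \<in> ksubsets n k. x \<in> S} = (n - 1) choose (k - 1)"
  using card_ksubsets_superset[of "{x}" n k] assms by simp

lemma card_ksubsets_two_members:
  assumes "x \<in> {1..n}" "y \<in> {1..n}" "x \<noteq> y" "2 \<le> k"
  shows "card {S \<in> ksubsets n k. x \<in> S \<and> y \<in> S} = (n - 2) choose (k - 2)"
  using card_ksubsets_superset[of "{x, y}" n k] assms by (simp add: numeral_2_eq_2)

text \<open>The matrix counting the k-sets through \<open>x\<close> and \<open>y\<close> has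
  \<open>?N\<close> on the diagonal and \<open>?M\<close> elsewhere. Its constant part
  \<open>?M\<close> annihilates weights of sum zero, so these are eigenvectors for
  \<open>?N - ?M\<close>.\<close>

lemma sum_ksubsets_linear_square:
  fixes w :: "nat \<Rightarrow> real"
  assumes k: "2 \<le> k" and w: "(\<Sum>x\<in>{1..n}. w x) = 0"
  shows "(\<Sum>S\<in>ksubsets n k. (\<Sum>x\<in>S. w x)\<^sup>2)
    = (real ((n - 1) choose (k - 1)) - real ((n - 2) choose (k - 2))) * (\<Sum>x\<in>{1..n}. (w x)\<^sup>2)"
    (is "_ = (?N - ?M) * _")
proof -
  let ?K = "ksubsets n k" and ?X = "{1..n}"
  have inner: "(\<Sum>S\<in>{S\<in>?K. x \<in> S}. \<Sum>y\<in>S. w y) = (?N - ?M) * w x" if x: "x \<in> ?X" for x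
  proof -
    have "(\<Sum>S\<in>{S\<in>?K. x \<in> S}. \<Sum>y\<in>S. w y)
        = (\<Sum>y\<in>?X. real (card {S\<in>{S\<in>?K. x \<in> S}. y \<in> S}) * w y)"
      by (rule sum_sum_members) (auto simp: ksubsets_def)
    also have "\<dots> = (\<Sum>y\<in>?X. ?M * w y + (if y = x then (?N - ?M) * w y else 0))"
    proof (intro sum.cong refl)
      fix y assume y: "y \<in> ?X"
      show "real (card {S\<in>{S\<in>?K. x \<in> S}. y \<in> S}) * w y
          = ?M * w y + (if y = x then (?N - ?M) * w y else 0)"
        using card_ksubsets_member[OF x, of k] card_ksubsets_two_members[OF x y, of k] k
        by (auto simp: algebra_simps)
    qed
    also have "\<dots> = (?N - ?M) * w x"
      using x w by (simp add: sum.distrib sum_distrib_left[symmetric])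
    finally show ?thesis .
  qed
  have "(\<Sum>S\<in>?K. (\<Sum>x\<in>S. w x)\<^sup>2) = (\<Sum>S\<in>?K. \<Sum>x\<in>{x\<in>?X. x \<in> S}. w x * (\<Sum>y\<in>S. w y))"
  proof (intro sum.cong refl)
    fix S assume "S \<in> ?K"
    then have "{x\<in>?X. x \<in> S} = S" by (auto simp: ksubsets_def)
    then show "(\<Sum>x\<in>S. w x)\<^sup>2 = (\<Sum>x\<in>{x\<in>?X. x \<in> S}. w x * (\<Sum>y\<in>S. w y))"
      by (simp add: power2_eq_square sum_distrib_right)
  qed
  also have "\<dots> = (\<Sum>x\<in>?X. \<Sum>S\<in>{S\<in>?K. x \<in> S}. w x * (\<Sum>y\<in>S. w y))"
    by (intro sum.swap_restrict) auto
  also have "\<dots> = (\<Sum>x\<in>?X. (?N - ?M) * (w x)\<^sup>2)"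
    using inner
    by (intro sum.cong refl) (simp add: sum_distrib_left[symmetric] power2_eq_square)
  finally show ?thesis by (simp only: sum_distrib_left)
qed

section \<open>Projection onto the affine functions\<close>

text \<open>The orthogonal projection of the indicator function of \<open>F\<close> onto the space of affine
  functions \<open>S \<mapsto> c + (\<Sum>x\<in>S. w x)\<close> on the \<open>k\<close>-sets.\<close>

definition affine_part :: "nat \<Rightarrow> nat \<Rightarrow> nat set set \<Rightarrow> nat set \<Rightarrow> real" where
  "affine_part n k F S = real (card F) / real (n choose k)
     + (\<Sum>x\<in>S. (real (card {A\<in>F. x \<in> A}) - real k * real (card F) / real n)
          / (real ((n - 1) choose (k - 1)) - real ((n - 2) choose (k - 2))))"

text \<open>The squared distance from the indicator function to its projection; it vanishes iff the
  two agree on every k-set.\<close>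

definition affine_defect :: "nat \<Rightarrow> nat \<Rightarrow> nat set set \<Rightarrow> real" where
  "affine_defect n k F = (\<Sum>S\<in>ksubsets n k. (of_bool (S \<in> F) - affine_part n k F S)\<^sup>2)"

text \<open>Absorption expresses all three binomials through one of them. Strictness, from Pascal's
  rule and \<open>k < n\<close>, makes the denominator in \<open>affine_part\<close>
  positive.\<close>

lemma binomial_relations:
  assumes k: "2 \<le> k" "k < n"
  shows "real k * real (n choose k) = real n * real ((n - 1) choose (k - 1))"
    and "(real n - 1) * real ((n - 2) choose (k - 2)) = (real k - 1) * real ((n - 1) choose (k - 1))"
    and "real ((n - 2) choose (k - 2)) < real ((n - 1) choose (k - 1))"
    and "1 \<le> (n - 2) choose (k - 2)"
proof -
  have "k * (n choose k) = n * ((n - 1) choose (k - 1))"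
    using binomial_absorption[of "k - 1" n] k by simp
  then show "real k * real (n choose k) = real n * real ((n - 1) choose (k - 1))"
    by (metis of_nat_mult)
  have "Suc (k - 2) * ((n - 1) choose Suc (k - 2)) = (n - 1) * ((n - 1 - 1) choose (k - 2))"
    by (rule binomial_absorption)
  moreover have "Suc (k - 2) = k - 1" "n - 1 - 1 = n - 2" using k by auto
  ultimately have "real (k - 1) * real ((n - 1) choose (k - 1))
      = real (n - 1) * real ((n - 2) choose (k - 2))"
    by (metis of_nat_mult)
  then show "(real n - 1) * real ((n - 2) choose (k - 2)) = (real k - 1) * real ((n - 1) choose (k - 1))"
    using k by (simp add: of_nat_diff)
  have "(n - 1) choose (k - 1) = ((n - 2) choose (k - 2)) + ((n - 2) choose (k - 1))"
    using choose_reduce_nat[of "n - 1" "k - 1"] k by (simp add: numeral_2_eq_2)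
  moreover have "0 < (n - 2) choose (k - 1)" using k by (intro zero_less_binomial) auto
  ultimately show "real ((n - 2) choose (k - 2)) < real ((n - 1) choose (k - 1))" by linarith
  have "0 < (n - 2) choose (k - 2)" using k by (intro zero_less_binomial) auto
  then show "1 \<le> (n - 2) choose (k - 2)" by linarith
qed

lemma sum_degrees:
  assumes "F \<subseteq> ksubsets n k"
  shows "(\<Sum>x\<in>{1..n}. real (card {A\<in>F. x \<in> A})) = real k * real (card F)"
proof -
  have "(\<Sum>A\<in>F. \<Sum>x\<in>A. 1) = (\<Sum>A\<in>F. real k)"
    using assms by (intro sum.cong refl) (auto simp: ksubsets_def)
  then show ?thesis
    using sum_sum_members[of "{1..n}" F "\<lambda>_. 1"] assms ksubsets_subset_Pow[of n k]
    by (simp add: mult.commute)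
qed

text \<open>Pythagoras: the indicator has squared norm \<open>m\<close>, its constant component
  \<open>m\<^sup>2 / C\<close>, and its centred linear component \<open>E / L\<close>, where
  \<open>E\<close> is the sum of squared degree deviations.\<close>

lemma affine_defect_eq:
  assumes k: "2 \<le> k" "k < n" and F: "F \<subseteq> ksubsets n k"
  defines "m \<equiv> real (card F)"
    and "L \<equiv> real ((n - 1) choose (k - 1)) - real ((n - 2) choose (k - 2))"
  shows "L * affine_defect n k F = L * m - L * m\<^sup>2 / real (n choose k)
     - (\<Sum>x\<in>{1..n}. (real (card {A\<in>F. x \<in> A}))\<^sup>2) + (real k)\<^sup>2 * m\<^sup>2 / real n"
proof -
  let ?K = "ksubsets n k" and ?X = "{1..n}"
  define C where "C = real (n choose k)"
  define d where "d x = real (card {A\<in>F. x \<in> A})" for x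
  \<comment> \<open>Deviation from the average degree. These weights sum to zero, which makes
    \<open>h\<close> orthogonal to the constants.\<close>
  define e where "e x = d x - real k * m / real n" for x
  define h where "h S = (\<Sum>x\<in>S. e x)" for S
  define E where "E = (\<Sum>x\<in>?X. (e x)\<^sup>2)"
  define f :: "nat set \<Rightarrow> real" where "f S = of_bool (S \<in> F)" for S
  have L: "L > 0" unfolding L_def using binomial_relations(3)[OF k] by simp
  have C: "C > 0" unfolding C_def using k by (simp add: zero_less_binomial)
  have n: "real n > 0" using k by simp
  have sum_d: "(\<Sum>x\<in>?X. d x) = real k * m"
    unfolding d_def m_def using F by (rule sum_degrees)
  have sum_e: "(\<Sum>x\<in>?X. e x) = 0"
    unfolding e_def using sum_d n by (simp add: sum_subtractf)
  have E_d: "E = (\<Sum>x\<in>?X. (d x)\<^sup>2) - (real k)\<^sup>2 * m\<^sup>2 / real n"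
  proof -
    have "E = (\<Sum>x\<in>?X. (d x)\<^sup>2 - 2 * (real k * m / real n) * d x + (real k * m / real n)\<^sup>2)"
      unfolding E_def e_def by (intro sum.cong refl) (simp add: power2_diff)
    also have "\<dots> = (\<Sum>x\<in>?X. (d x)\<^sup>2) - 2 * (real k * m / real n) * (\<Sum>x\<in>?X. d x)
        + real n * (real k * m / real n)\<^sup>2"
      by (simp add: sum.distrib sum_subtractf sum_distrib_left)
    also have "\<dots> = (\<Sum>x\<in>?X. (d x)\<^sup>2) - (real k)\<^sup>2 * m\<^sup>2 / real n"
      unfolding sum_d using n by (simp add: field_simps power2_eq_square)
    finally show ?thesis .
  qed
  have K_F: "?K \<inter> F = F" using F by blast
  have sum_f: "(\<Sum>S\<in>?K. f S) = m"
    unfolding f_def m_def by (simp add: of_bool_def sum.If_cases K_F)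
  have sum_fh: "(\<Sum>S\<in>?K. f S * h S) = E"
  proof -
    have "(\<Sum>S\<in>?K. f S * h S) = (\<Sum>S\<in>?K. if S \<in> F then h S else 0)"
      by (intro sum.cong refl) (simp add: f_def)
    also have "\<dots> = (\<Sum>S\<in>F. h S)" by (simp add: sum.If_cases K_F)
    also have "\<dots> = (\<Sum>x\<in>?X. d x * e x)"
      unfolding h_def d_def using subset_trans[OF F ksubsets_subset_Pow] by (intro sum_sum_members) simp_all
    \<comment> \<open>The degree is its deviation plus the average, and the average contributes
      nothing against \<open>e\<close>.\<close>
    also have "\<dots> = (\<Sum>x\<in>?X. (e x)\<^sup>2 + (real k * m / real n) * e x)"
      by (intro sum.cong refl) (simp add: e_def power2_eq_square algebra_simps)
    also have "\<dots> = E"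
      using sum_e by (simp only: sum.distrib sum_distrib_left[symmetric] E_def)
    finally show ?thesis .
  qed
  have sum_h: "(\<Sum>S\<in>?K. h S) = 0"
  proof -
    have "(\<Sum>S\<in>?K. h S) = (\<Sum>x\<in>?X. real (card {S\<in>?K. x \<in> S}) * e x)"
      unfolding h_def using ksubsets_subset_Pow by (rule sum_sum_members[OF finite_atLeastAtMost])
    also have "\<dots> = (\<Sum>x\<in>?X. real ((n - 1) choose (k - 1)) * e x)"
      using k by (intro sum.cong refl) (simp add: card_ksubsets_member)
    finally show ?thesis using sum_e by (simp add: sum_distrib_left[symmetric])
  qed
  have sum_h2: "(\<Sum>S\<in>?K. (h S)\<^sup>2) = L * E"
    unfolding h_def L_def E_def using k(1) sum_e by (rule sum_ksubsets_linear_square)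
  have "affine_defect n k F = (\<Sum>S\<in>?K. (f S - m / C - h S / L)\<^sup>2)"
    unfolding affine_defect_def affine_part_def f_def h_def e_def d_def m_def C_def L_def
    by (simp add: sum_divide_distrib diff_diff_eq)
  also have "\<dots> = (\<Sum>S\<in>?K. (1 - 2 * (m / C)) * f S + (m / C)\<^sup>2 + (1 / L\<^sup>2) * (h S)\<^sup>2
      - (2 / L) * (f S * h S) + (2 * (m / C) / L) * h S)"
  proof (intro sum.cong refl)
    fix S
    have "f S * f S = f S" by (simp add: f_def)
    moreover have "(f S - m / C - h S / L)\<^sup>2 = f S * f S - 2 * (m / C) * f S + (m / C)\<^sup>2
        + (1 / L\<^sup>2) * (h S)\<^sup>2 - (2 / L) * (f S * h S) + (2 * (m / C) / L) * h S"
      using L C by (simp add: field_simps power2_eq_square)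
    ultimately show "(f S - m / C - h S / L)\<^sup>2 = (1 - 2 * (m / C)) * f S + (m / C)\<^sup>2
        + (1 / L\<^sup>2) * (h S)\<^sup>2 - (2 / L) * (f S * h S) + (2 * (m / C) / L) * h S"
      by (simp add: algebra_simps)
  qed
  also have "\<dots> = (1 - 2 * (m / C)) * (\<Sum>S\<in>?K. f S) + C * (m / C)\<^sup>2
      + (1 / L\<^sup>2) * (\<Sum>S\<in>?K. (h S)\<^sup>2) - (2 / L) * (\<Sum>S\<in>?K. f S * h S)
      + (2 * (m / C) / L) * (\<Sum>S\<in>?K. h S)"
    by (simp only: sum.distrib sum_subtractf sum_distrib_left sum_constant card_ksubsets C_def)
  also have "\<dots> = m - m\<^sup>2 / C - E / L"
    unfolding sum_f sum_fh sum_h sum_h2 using L C by (simp add: field_simps power2_eq_square)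
  finally have "L * affine_defect n k F = L * (m - m\<^sup>2 / C - E / L)" by simp
  also have "\<dots> = L * m - L * m\<^sup>2 / C - E" using L by (simp add: right_diff_distrib)
  finally have "L * affine_defect n k F = L * m - L * m\<^sup>2 / C - E" .
  then show ?thesis using E_d by (simp add: C_def d_def)
qed

text \<open>Of the two terms on the right, the first vanishes iff the indicator function of \<open>F\<close> is affine,
  the second iff \<open>F\<close> has the size of a star.\<close>

lemma omega_deficit:
  assumes k: "2 \<le> k" "k < n" and F: "F \<subseteq> ksubsets n k"
  defines "m \<equiv> real (card F)"
    and "N \<equiv> real ((n - 1) choose (k - 1))" and "M \<equiv> real ((n - 2) choose (k - 2))"
  shows "2 * real (omega_bound n k) - 2 * real (omega F)
    = (N - M) * affine_defect n k F
      + (N - m) * (N - M - real k + real k * (real k - 1) / (real n - 1) * (N + m))"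
proof -
  define D where "D = (\<Sum>x\<in>{1..n}. (real (card {A\<in>F. x \<in> A}))\<^sup>2)"
  define C where "C = real (n choose k)"
  define \<kappa> where "\<kappa> = real k"
  define \<nu> where "\<nu> = real n"
  have pos: "\<nu> > 1" "\<kappa> > 1" "N > 0" "C > 0"
    using k by (simp_all add: \<nu>_def \<kappa>_def N_def C_def zero_less_binomial)
  have CN: "C = \<nu> * N / \<kappa>" and MN: "M = (\<kappa> - 1) * N / (\<nu> - 1)"
    using binomial_relations(1,2)[OF k] pos
    by (simp_all add: C_def N_def M_def \<nu>_def \<kappa>_def field_simps)
  have "2 * real (omega F) = (\<Sum>x\<in>{1..n}. 2 * real (card {A\<in>F. x \<in> A} choose 2))"
    using omega_eq_sum_degrees[of "{1..n}" F] F ksubsets_subset_Pow[of n k]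
    by (simp add: sum_distrib_left)
  also have "\<dots> = (\<Sum>x\<in>{1..n}. (real (card {A\<in>F. x \<in> A}))\<^sup>2 - real (card {A\<in>F. x \<in> A}))"
    by (intro sum.cong refl) (simp add: two_times_choose_two power2_eq_square algebra_simps)
  also have "\<dots> = D - \<kappa> * m"
    using sum_degrees[OF F] by (simp add: sum_subtractf D_def m_def \<kappa>_def)
  finally have om: "2 * real (omega F) = D - \<kappa> * m" .
  have "2 * real (omega_bound n k) = 2 * real (((n - 1) choose (k - 1)) choose 2)
      + real (n - 1) * (2 * real (((n - 2) choose (k - 2)) choose 2))"
    by (simp add: omega_bound_def)
  also have "\<dots> = N * (N - 1) + (\<nu> - 1) * (M * (M - 1))"
    unfolding two_times_choose_two using k by (simp add: N_def M_def \<nu>_def of_nat_diff)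
  finally have bd: "2 * real (omega_bound n k) = N * (N - 1) + (\<nu> - 1) * (M * (M - 1))" .
  have def: "(N - M) * affine_defect n k F
      = (N - M) * m - (N - M) * m\<^sup>2 / C - D + \<kappa>\<^sup>2 * m\<^sup>2 / \<nu>"
    using affine_defect_eq[OF k F] by (simp add: D_def C_def N_def M_def m_def \<kappa>_def \<nu>_def)
  \<comment> \<open>With this coefficient the term
    \<open>\<kappa>\<^sup>2 * m\<^sup>2 / \<nu>\<close> cancels from the defect.\<close>
  have LC: "(N - M) / C = \<kappa>\<^sup>2 / \<nu> - \<kappa> * (\<kappa> - 1) / (\<nu> - 1)"
    unfolding CN MN using pos by (simp add: field_simps power2_eq_square)
  have "(N - M) * m\<^sup>2 / C = (\<kappa>\<^sup>2 / \<nu> - \<kappa> * (\<kappa> - 1) / (\<nu> - 1)) * m\<^sup>2"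
    using LC by (metis times_divide_eq_left)
  with def have "(N - M) * affine_defect n k F
      = (N - M) * m + \<kappa> * (\<kappa> - 1) / (\<nu> - 1) * m\<^sup>2 - D"
    by (simp add: algebra_simps)
  \<comment> \<open>Twice \<open>omega F\<close> plus the defect term is a quadratic in
    \<open>m\<close>, and twice the bound is the same quadratic at \<open>N\<close>; hence the
    factor \<open>N - m\<close> in the difference.\<close>
  moreover have "N * (N - 1) + (\<nu> - 1) * (M * (M - 1))
      = (N - M - \<kappa>) * N + \<kappa> * (\<kappa> - 1) / (\<nu> - 1) * N\<^sup>2"
  proof -
    have "\<kappa> * (\<kappa> - 1) / (\<nu> - 1) * N\<^sup>2 = \<kappa> * M * N"
      unfolding MN by (simp add: power2_eq_square)
    moreover have "(\<nu> - 1) * (M * (M - 1)) = (\<kappa> - 1) * N * (M - 1)"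
      unfolding MN using pos by simp
    ultimately show ?thesis by (simp add: power2_eq_square algebra_simps)
  qed
  moreover define \<gamma> where "\<gamma> = \<kappa> * (\<kappa> - 1) / (\<nu> - 1)"
  ultimately show ?thesis
    unfolding om bd \<kappa>_def[symmetric] \<nu>_def[symmetric] \<gamma>_def[symmetric]
    by (simp add: power2_eq_square algebra_simps)
qed

section \<open>Intersecting families with affine indicator function\<close>

text \<open>Weights cannot be constant, since all k-sets together are not intersecting. Two elements
  heavier than a third would give disjoint members, so a single \<open>x\<close> outweighs all
  others, and membership means containing \<open>x\<close>.\<close>

lemma intersecting_affine_imp_star:
  fixes a :: "nat \<Rightarrow> real"
  assumes n: "2 * k < n" "0 < k" and F: "F \<subseteq> ksubsets n k" "intersecting F" "F \<noteq> {}"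
    and aff: "\<And>S. S \<in> ksubsets n k \<Longrightarrow> of_bool (S \<in> F) = c + (\<Sum>x\<in>S. a x)"
  shows "\<exists>x\<in>{1..n}. F = full_star n k x"
proof -
  let ?K = "ksubsets n k" and ?X = "{1..n}"
  \<comment> \<open>Exchanging \<open>x\<close> for the lighter \<open>y\<close> strictly lowers the
    affine value; as only 0 and 1 occur, it falls from 1 to 0.\<close>
  have swap: "S \<in> F \<and> insert y (S - {x}) \<notin> F"
    if S: "S \<in> ?K" "x \<in> S" "y \<notin> S" "y \<in> ?X" "a y < a x" for S x y
  proof -
    have fS: "finite S" using S finite_member_ksubsets by blast
    have "card (insert y (S - {x})) = card S"
      using S fS by (metis Diff_iff card.insert card.remove finite_Diff)
    then have "insert y (S - {x}) \<in> ?K" using S by (auto simp: ksubsets_def)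
    then have "of_bool (insert y (S - {x}) \<in> F) = c + (\<Sum>z\<in>insert y (S - {x}). a z)"
      by (rule aff)
    also have "\<dots> = c + (\<Sum>z\<in>S. a z) - a x + a y"
      using S fS by (simp add: sum_diff1)
    also have "\<dots> < of_bool (S \<in> F)" using aff[OF S(1)] S by simp
    finally show ?thesis by (auto simp: of_bool_def split: if_splits)
  qed
  have up: "S \<in> F" if "S \<in> ?K" "x \<in> S" "y \<notin> S" "y \<in> ?X" "a y < a x" for S x y
    using swap that by blast
  \<comment> \<open>The same exchange read backwards: \<open>S\<close> arises from a k-set by
    replacing \<open>x\<close> with \<open>y\<close>.\<close>
  have down: "S \<notin> F" if S: "S \<in> ?K" "y \<in> S" "x \<notin> S" "x \<in> ?X" "a y < a x" for S x y
  proof -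
    have fS: "finite S" using S finite_member_ksubsets by blast
    let ?S = "insert x (S - {y})"
    have "card ?S = card S"
      using S fS by (metis Diff_iff card.insert card.remove finite_Diff)
    then have "?S \<in> ?K" using S by (auto simp: ksubsets_def)
    moreover have "y \<notin> ?S" "y \<in> ?X" using S by (auto simp: ksubsets_def)
    ultimately have "insert y (?S - {x}) \<notin> F" using swap[of ?S x y] S by blast
    moreover have "insert y (?S - {x}) = S" using S by auto
    ultimately show ?thesis by simp
  qed
  have "\<exists>x\<in>?X. \<exists>y\<in>?X. a y < a x"
  proof (rule ccontr)
    assume "\<not> ?thesis"
    then have le: "a x \<le> a y" if "x \<in> ?X" "y \<in> ?X" for x y
      using that by (meson not_le)
    have const: "a x = a 1" if "x \<in> ?X" for x
      using le[of x 1] le[of 1 x] that n by simp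
    have "of_bool (S \<in> F) = c + real k * a 1" if "S \<in> ?K" for S
    proof -
      have "(\<Sum>x\<in>S. a x) = (\<Sum>x\<in>S. a 1)"
        by (intro sum.cong refl, rule const) (use that in \<open>auto simp: ksubsets_def\<close>)
      then show ?thesis using aff[OF that] that by (simp add: ksubsets_def)
    qed
    moreover obtain A where "A \<in> F" "A \<in> ?K" using F by auto
    ultimately have "S \<in> F" if "S \<in> ?K" for S
      using that by (metis of_bool_eq_iff)
    moreover have "{1..k} \<in> ?K" "{k+1..2*k} \<in> ?K" using n by (auto simp: ksubsets_def)
    ultimately have "{1..k} \<inter> {k+1..2*k} \<noteq> {}" using F(2) unfolding intersecting_def by blast
    then show False by auto
  qed
  then obtain x y where xy: "x \<in> ?X" "y \<in> ?X" "a y < a x" by blast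
  have eq: "a z = a y" if z: "z \<in> ?X" "z \<noteq> x" "z \<noteq> y" for z
  proof -
    have xny: "x \<noteq> y" using xy by auto
    \<comment> \<open>Two disjoint sets of size \<open>k - 1\<close> avoiding the three points fit
      because \<open>2 * k < n\<close> gives \<open>2 * (k - 1) \<le> n - 3\<close>.\<close>
    have "card (?X - {x, y, z}) = n - 3"
      using xy z xny by (subst card_Diff_subset) auto
    then have "k - 1 \<le> card (?X - {x, y, z})" using n by simp
    then obtain T where T: "T \<subseteq> ?X - {x, y, z}" "card T = k - 1" "finite T"
      by (rule obtain_subset_with_card_n)
    have "card (?X - {x, y, z} - T) = n - 3 - (k - 1)"
      using T \<open>card (?X - {x, y, z}) = n - 3\<close> by (simp add: card_Diff_subset)
    then have "k - 1 \<le> card (?X - {x, y, z} - T)" using n by simp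
    then obtain U where U: "U \<subseteq> ?X - {x, y, z} - T" "card U = k - 1" "finite U"
      by (rule obtain_subset_with_card_n)
    have ins: "insert v T \<in> ?K" "insert v U \<in> ?K" if "v \<in> {x, y, z}" for v
    proof -
      have "v \<notin> T" "v \<notin> U" "v \<in> ?X" using that T U xy z by auto
      then show "insert v T \<in> ?K" "insert v U \<in> ?K"
        using T U n by (auto simp: ksubsets_def)
    qed
    have "\<not> a y < a z"
    proof
      assume "a y < a z"
      then have "insert z U \<in> F" using up[of "insert z U" z y] ins U xy z by auto
      moreover have "insert x T \<in> F" using up[of "insert x T" x y] ins T xy xny by auto
      moreover have "insert z U \<inter> insert x T = {}" using T U z by auto
      ultimately show False using F(2) unfolding intersecting_def by blast
    qed
    \<comment> \<open>Here \<open>insert y T\<close> omits the lighter \<open>z\<close>, which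
      forces membership, and the heavier \<open>x\<close>, which forbids it.\<close>
    moreover have "\<not> a z < a y"
    proof
      assume "a z < a y"
      then have "insert y T \<in> F" using up[of "insert y T" y z] ins T xy z by auto
      moreover have "insert y T \<notin> F" using down[of "insert y T" y x] ins T xy xny by auto
      ultimately show False by blast
    qed
    ultimately show ?thesis by linarith
  qed
  have less: "a z < a x" if "z \<in> ?X" "z \<noteq> x" for z
    using eq that xy by (cases "z = y") auto
  have "S \<in> F \<longleftrightarrow> x \<in> S" if S: "S \<in> ?K" for S
  proof
    assume "S \<in> F"
    have "S \<noteq> {}" using S n by (auto simp: ksubsets_def)
    then obtain z where z: "z \<in> S" by blast
    then have "z \<in> ?X" using S by (auto simp: ksubsets_def)
    then show "x \<in> S" using down[OF S z _ xy(1)] less z \<open>S \<in> F\<close> by blast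
  next
    assume x: "x \<in> S"
    have "\<not> ?X \<subseteq> S"
      using S n card_mono[OF finite_member_ksubsets[OF S], of ?X] by (auto simp: ksubsets_def)
    then obtain z where "z \<in> ?X" "z \<notin> S" by blast
    then show "S \<in> F" using up[OF S x] less x by blast
  qed
  then have "F = full_star n k x" using F(1) by (auto simp: full_star_def)
  then show ?thesis using xy by blast
qed

section \<open>Stars\<close>

text \<open>The centre meets all members; every other point has the codegree with the centre as its
  degree. These are the two terms of the bound.\<close>

lemma omega_full_star:
  assumes "x \<in> {1..n}" "2 \<le> k"
  shows "omega (full_star n k x) = omega_bound n k"
proof -
  have "omega (full_star n k x)
      = (\<Sum>y\<in>{1..n}. card {A\<in>full_star n k x. y \<in> A} choose 2)"
    by (rule omega_eq_sum_degrees) (auto simp: full_star_def ksubsets_def)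
  also have "\<dots> = (card {A\<in>full_star n k x. x \<in> A} choose 2)
      + (\<Sum>y\<in>{1..n} - {x}. card {A\<in>full_star n k x. y \<in> A} choose 2)"
    using assms by (intro sum.remove) auto
  also have "{A\<in>full_star n k x. x \<in> A} = {S\<in>ksubsets n k. x \<in> S}"
    by (auto simp: full_star_def)
  also have "(\<Sum>y\<in>{1..n} - {x}. card {A\<in>full_star n k x. y \<in> A} choose 2)
      = (\<Sum>y\<in>{1..n} - {x}. ((n - 2) choose (k - 2)) choose 2)"
  proof (intro sum.cong refl)
    fix y assume "y \<in> {1..n} - {x}"
    then show "card {A\<in>full_star n k x. y \<in> A} choose 2 = ((n - 2) choose (k - 2)) choose 2"
      using card_ksubsets_two_members[of x n y k] assms by (auto simp: full_star_def conj_assoc)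
  qed
  finally show ?thesis
    using assms card_ksubsets_member[of x n k] by (simp add: omega_bound_def)
qed

lemma full_star_permutes_image:
  assumes p: "p permutes {1..n}"
  shows "(\<lambda>S. p ` S) ` full_star n k x = full_star n k (p x)"
proof (intro equalityI subsetI)
  fix T assume "T \<in> (\<lambda>S. p ` S) ` full_star n k x"
  then show "T \<in> full_star n k (p x)"
    using ksubsets_permutes_image[OF _ p] by (auto simp: full_star_def)
next
  fix T assume T: "T \<in> full_star n k (p x)"
  have "inv p ` T \<in> ksubsets n k"
    using T ksubsets_permutes_image[OF _ permutes_inv[OF p]] by (simp add: full_star_def)
  moreover have "x \<in> inv p ` T"
    using T permutes_inverses(2)[OF p, of x] by (force simp: full_star_def)
  moreover have "T = p ` (inv p ` T)"
    using permutes_surj[OF p] by (simp add: image_f_inv_f)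
  ultimately show "T \<in> (\<lambda>S. p ` S) ` full_star n k x"
    by (auto simp: full_star_def)
qed

text \<open>A permutation moves the centre from 1 to \<open>p 1\<close>; conversely the
  transposition of 1 and \<open>x\<close> reaches any centre.\<close>

lemma permuted_star_iff:
  assumes "1 \<le> n"
  shows "(\<exists>p. p permutes {1..n} \<and> F = (\<lambda>S. p ` S) ` full_star n k 1)
    \<longleftrightarrow> (\<exists>x\<in>{1..n}. F = full_star n k x)"
proof
  assume "\<exists>p. p permutes {1..n} \<and> F = (\<lambda>S. p ` S) ` full_star n k 1"
  then obtain p where p: "p permutes {1..n}" "F = full_star n k (p 1)"
    using full_star_permutes_image by metis
  moreover have "p 1 \<in> {1..n}" using permutes_in_image[OF p(1)] assms by simp
  ultimately show "\<exists>x\<in>{1..n}. F = full_star n k x" by blast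
next
  assume "\<exists>x\<in>{1..n}. F = full_star n k x"
  then obtain x where x: "x \<in> {1..n}" "F = full_star n k x" by blast
  have "transpose 1 x permutes {1..n}" using x assms by (intro permutes_swap_id) auto
  moreover from this have "F = (\<lambda>S. transpose 1 x ` S) ` full_star n k 1"
    using x by (simp add: full_star_permutes_image)
  ultimately show "\<exists>p. p permutes {1..n} \<and> F = (\<lambda>S. p ` S) ` full_star n k 1" by blast
qed

section \<open>Degenerate cases and the final assembly\<close>

lemma omega_eq_0_of_card_le_1:
  assumes "finite F" "card F \<le> 1"
  shows "omega F = 0"
proof -
  have "\<not> (P \<subseteq> F \<and> card P = 2)" for P
    using card_mono[OF assms(1), of P] assms(2) by auto
  then have "{P. P \<subseteq> F \<and> card P = 2} = {}" by blast
  then show ?thesis by (simp only: omega_def sum.empty)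
qed

lemma ksubsets_0: "ksubsets n 0 = {{}}"
proof -
  have "S = {}" if "S \<in> ksubsets n 0" for S
    using finite_member_ksubsets[OF that] that by (simp add: ksubsets_def)
  then show ?thesis by (auto simp: ksubsets_def)
qed

text \<open>Both lower indices truncate to 0, so the inner binomials are 1 and contain no
  pairs.\<close>

lemma omega_bound_eq_0: "k \<le> 1 \<Longrightarrow> omega_bound n k = 0"
  by (simp add: omega_bound_def)

text \<open>The excluded case is genuine: for \<open>k = 1\<close> the bound is 0, and the empty
  family attains it without being a star.\<close>

theorem theorem2:
  fixes n k :: nat and F :: "nat set set"
  assumes "n \<ge> 2 * k"
    and "F \<subseteq> ksubsets n k"
    and "intersecting F"
  shows "omega F \<le> omega_bound n k
    \<and> (n > 2 * k \<and> \<not> (k = 1 \<and> F = {}) \<longrightarrow>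
         (omega F = omega_bound n k \<longleftrightarrow>
            (\<exists>p. p permutes {1..n} \<and> F = (\<lambda>S. p ` S) ` full_star n k 1))
       \<and> (omega F = omega_bound n k \<longleftrightarrow>
            (\<exists>x\<in>{1..n}. F = full_star n k x)))"
proof -
  have fF: "finite F" using assms(2) finite_subset finite_ksubsets by blast
  have main: "omega F \<le> omega_bound n k
    \<and> (n > 2 * k \<and> \<not> (k = 1 \<and> F = {}) \<longrightarrow>
         (omega F = omega_bound n k \<longleftrightarrow> (\<exists>x\<in>{1..n}. F = full_star n k x)))"
  proof -
    consider "k = 0" | "k = 1" | "2 \<le> k" by linarith
    then show ?thesis
    proof cases
      case 1
      have "F = {}"
      proof (rule ccontr)
        assume "F \<noteq> {}"
        then obtain A where A: "A \<in> F" by blast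
        then have "A = {}" using assms(2) 1 by (auto simp: ksubsets_0)
        then show False using A assms(3) by (auto simp: intersecting_def)
      qed
      moreover have "full_star n 0 x = {}" for x
        by (auto simp: full_star_def ksubsets_0)
      ultimately show ?thesis
        using 1 by (auto simp: omega_eq_0_of_card_le_1 omega_bound_eq_0 intro!: bexI[of _ 1])
    next
      case 2
      have one: "F = {A}" if "A \<in> F" for A
      proof -
        have "B = A" if "B \<in> F" for B
        proof -
          have "card A = 1" "card B = 1" "A \<inter> B \<noteq> {}"
            using that \<open>A \<in> F\<close> assms(2,3) 2 by (auto simp: ksubsets_def intersecting_def)
          then show ?thesis by (auto simp: card_1_singleton_iff)
        qed
        then show ?thesis using that by blast
      qed
      have "card F \<le> 1"
      proof (cases "F = {}")
        case False
        then obtain A where "A \<in> F" by blast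
        then show ?thesis using one[of A] by (metis card_1_singleton_iff One_nat_def order_refl)
      qed simp
      then have "omega F = omega_bound n k"
        using 2 fF by (simp add: omega_eq_0_of_card_le_1 omega_bound_eq_0)
      moreover have "\<exists>x\<in>{1..n}. F = full_star n k x" if ne: "F \<noteq> {}"
      proof -
        obtain A where A: "A \<in> F" using ne by blast
        then obtain x where x: "A = {x}" "x \<in> {1..n}"
          using assms(2) 2 by (auto simp: ksubsets_def card_1_singleton_iff)
        have "full_star n k x = {{x}}"
          using 2 x by (auto simp: full_star_def ksubsets_def card_1_singleton_iff)
        then show ?thesis using one[OF A] x by blast
      qed
      ultimately show ?thesis using 2 by simp
    next
      case 3
      define m where "m = real (card F)"
      define N where "N = real ((n - 1) choose (k - 1))"
      define M where "M = real ((n - 2) choose (k - 2))"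
      define R where "R = N - M - real k + real k * (real k - 1) / (real n - 1) * (N + m)"
      have kn: "k < n" using 3 assms(1) by simp
      note rel = binomial_relations[OF 3 kn, folded N_def M_def]
      have eq: "2 * real (omega_bound n k) - 2 * real (omega F)
          = (N - M) * affine_defect n k F + (N - m) * R"
        unfolding R_def N_def M_def m_def using 3 kn assms(2) by (rule omega_deficit)
      have "card F \<le> (n - 1) choose (k - 1)"
        using assms 3 by (intro erdos_ko_rado) auto
      then have mN: "m \<le> N" by (simp add: m_def N_def)
      \<comment> \<open>Positivity of \<open>R\<close>: the part of its last term coming from
        \<open>N\<close> equals \<open>k * M\<close>, which offsets \<open>- k\<close> because
        \<open>M \<ge> 1\<close>; then \<open>N > M\<close> remains.\<close>
      have "real k * (real k - 1) / (real n - 1) * N = real k * ((real k - 1) * N) / (real n - 1)"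
        by simp
      also have "\<dots> = real k * M" using 3 kn by (simp flip: rel(2))
      finally have "real k * (real k - 1) / (real n - 1) * N = real k * M" .
      moreover have "0 \<le> real k * (real k - 1) / (real n - 1) * m"
        using 3 kn by (simp add: m_def)
      moreover have "real k * M \<ge> real k"
        using rel(4) 3 by (simp add: M_def)
      ultimately have R: "R > 0"
        using rel(3) by (simp add: R_def distrib_left)
      have defect: "0 \<le> affine_defect n k F"
        unfolding affine_defect_def by (intro sum_nonneg) simp
      have nn: "0 \<le> (N - M) * affine_defect n k F" "0 \<le> (N - m) * R"
        using defect rel(3) mN R by simp_all
      have le: "omega F \<le> omega_bound n k" using eq nn by linarith
      have "\<exists>x\<in>{1..n}. F = full_star n k x" if n: "2 * k < n" and om: "omega F = omega_bound n k"
      proof -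
        \<comment> \<open>Two nonnegative terms with sum zero both vanish: the first gives the size
          of a star, the second an affine indicator function.\<close>
        have "(N - m) * R = 0" "(N - M) * affine_defect n k F = 0"
          using eq nn om by linarith+
        then have "m = N" and d0: "affine_defect n k F = 0" using R rel(3) by auto
        have "N > 0" using 3 kn by (simp add: N_def zero_less_binomial)
        then have "F \<noteq> {}" using \<open>m = N\<close> by (auto simp: m_def)
        have "of_bool (S \<in> F) = affine_part n k F S" if "S \<in> ksubsets n k" for S
          using d0 that unfolding affine_defect_def by (simp add: sum_nonneg_eq_0_iff)
        then show ?thesis
          using n 3 assms(2,3) \<open>F \<noteq> {}\<close> unfolding affine_part_def
          by (intro intersecting_affine_imp_star) auto
      qed
      then show ?thesis using le 3 omega_full_star by blast
    qed
  qed
  show ?thesis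
  \<comment> \<open>The element 1 lies in the ground set only for positive \<open>n\<close>; at
    \<open>n = 0\<close> the condition \<open>n > 2 * k\<close> fails.\<close>
  proof (cases "n = 0")
    case True
    then show ?thesis using main by simp
  next
    case False
    then show ?thesis using main permuted_star_iff[of n F k] by simp
  qed
qed

end
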